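(* Let $m,n\ge 1$ be integers and let $A=\mathbb{Z}\langle x_1,x_2\rangle/(x_1^m,x_2^n)$, bigraded by the degrees in $x_1$ and $x_2$. For $a,b\ge 0$ let $N_2(A)_{(a,b)}$ be the component of $N_2(A)$ of degree $a$ in $x_1$ and degree $b$ in $x_2$. Then, as abelian groups, $$N_2(A)_{(a,b)}\cong\begin{cases}\mathbb{Z} & 1\le a\le m-1,\ 1\le b\le n-1,\\ \mathbb{Z}/n\mathbb{Z} & 1\le a\le m-1,\ b=n,\\ \mathbb{Z}/m\mathbb{Z} & a=m,\ 1\le b\le n-1,\\ \mathbb{Z}/\gcd(m,n)\mathbb{Z} & a=m,\ b=n,\\ 0 & \text{otherwise.}\end{cases}$$
   Context: For an associative ring $A$, define $L_1(A)=A$ and $L_{i+1}(A)=[A,L_i(A)]$ (the additive span of all commutators $[a,l]=al-la$ with $a\in A$, $l\in L_i(A)$), $M_i(A)=A\,L_i(A)\,A$ (the two-sided ideal generated by $L_i(A)$), and $N_i(A)=M_i(A)/M_{i+1}(A)$. Since the relations $x_1^m,x_2^n$ are homogeneous in $x_1$ and $x_2$, the bigrading of the free ring $\mathbb{Z}\langle x_1,x_2\rangle$ by (degree in $x_1$, degree in $x_2$) passes to $A$ and to $N_i(A)$. *)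

theory Defs
  imports
    "HOL-Library.Poly_Mapping"
    "HOL-Algebra.QuotRing"
    "HOL-Algebra.Generated_Groups"
    "HOL-Algebra.Elementary_Groups"
    "HOL-Algebra.Algebraic_Closure_Type"
begin

text \<open>The series is indexed from 1, as \<open>L\<^sub>1(A) = A\<close>; the value at index 0 is a dummy.\<close>

fun lower_central :: "('a, 'b) ring_scheme \<Rightarrow> nat \<Rightarrow> 'a set" where
  "lower_central A 0 = carrier A"
| "lower_central A (Suc 0) = carrier A"
| "lower_central A (Suc (Suc i)) =
     generate (add_monoid A)
       {a \<otimes>\<^bsub>A\<^esub> l \<ominus>\<^bsub>A\<^esub> l \<otimes>\<^bsub>A\<^esub> a | a l. a \<in> carrier A \<and> l \<in> lower_central A (Suc i)}"

definition lower_ideal :: "('a, 'b) ring_scheme \<Rightarrow> nat \<Rightarrow> 'a set" where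
  "lower_ideal A i = Idl\<^bsub>A\<^esub> (lower_central A i)"

definition lower_quotient :: "('a, 'b) ring_scheme \<Rightarrow> nat \<Rightarrow> 'a set monoid" where
  "lower_quotient A i =
     add_monoid (A\<lparr>carrier := lower_ideal A i\<rparr>) Mod lower_ideal A (Suc i)"

text \<open>
  If \<open>H\<close> is a homogeneous component of a grading of \<open>A\<close>, the corresponding component of
  \<open>N\<^sub>i(A) = M\<^sub>i(A) / M\<^sub>i\<^sub>+\<^sub>1(A)\<close> consists of the classes of those elements of \<open>M\<^sub>i(A)\<close> lying in \<open>H\<close>.
\<close>

definition lower_quotient_component ::
    "('a, 'b) ring_scheme \<Rightarrow> 'a set \<Rightarrow> nat \<Rightarrow> 'a set monoid" where
  "lower_quotient_component A H i =
     (lower_quotient A i)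
       \<lparr>carrier := {lower_ideal A (Suc i) +>\<^bsub>A\<^esub> x | x. x \<in> lower_ideal A i \<inter> H}\<rparr>"

text \<open>
  Finitely supported functions from a monoid, written additively, to the integers carry the
  convolution product. For the monoid of words under concatenation this is the free ring.
\<close>

datatype 'v free_monoid = Word (letters: "'v list")

instantiation free_monoid :: (type) monoid_add
begin

definition zero_free_monoid :: "'a free_monoid" where
  "0 = Word []"

definition plus_free_monoid :: "'a free_monoid \<Rightarrow> 'a free_monoid \<Rightarrow> 'a free_monoid" where
  "u + v = Word (letters u @ letters v)"

instance
  by standard (simp_all add: zero_free_monoid_def plus_free_monoid_def)

end

datatype two = X1 | X2

type_synonym free_ring2 = "two free_monoid \<Rightarrow>\<^sub>0 int"

abbreviation Free2 :: "free_ring2 ring" where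
  "Free2 \<equiv> ring_of_type_algebra"

lemma ring_Free2: "ring Free2"
proof -
  have "\<exists>y. x + y = 0" for x :: free_ring2
    using add.right_inverse by blast
  then show ?thesis
    unfolding ring_of_type_algebra_def using add.right_inverse
    by unfold_locales (auto simp: algebra_simps Units_def)
qed

definition gen :: "two \<Rightarrow> free_ring2" where
  "gen v = Poly_Mapping.single (Word [v]) 1"

definition bihomogeneous :: "nat \<Rightarrow> nat \<Rightarrow> free_ring2 set" where
  "bihomogeneous a b =
     {f. \<forall>w \<in> Poly_Mapping.keys f.
           count_list (letters w) X1 = a \<and> count_list (letters w) X2 = b}"

definition relations_ideal :: "nat \<Rightarrow> nat \<Rightarrow> free_ring2 set" where
  "relations_ideal m n = Idl\<^bsub>Free2\<^esub> {gen X1 ^ m, gen X2 ^ n}"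

definition truncated_ring :: "nat \<Rightarrow> nat \<Rightarrow> free_ring2 set ring" where
  "truncated_ring m n = Free2 Quot relations_ideal m n"

lemma ring_truncated_ring: "ring (truncated_ring m n)"
  unfolding truncated_ring_def relations_ideal_def
  by (intro ideal.quotient_is_ring ring.genideal_ideal ring_Free2)
    (simp add: ring_of_type_algebra_def)

definition truncated_component :: "nat \<Rightarrow> nat \<Rightarrow> nat \<Rightarrow> nat \<Rightarrow> free_ring2 set set" where
  "truncated_component m n a b =
     {relations_ideal m n +>\<^bsub>Free2\<^esub> f | f. f \<in> bihomogeneous a b}"

end

(* Modulo the ideal M_3 generated by all double commutators, u = [x_1, x_2] is central and
   u^2 = 0, so a word with a letters x_1 and b letters x_2 is congruent to
   x_1^a x_2^b - k x_1^(a-1) u x_2^(b-1), where k counts the pairs of letters with x_2 to the left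
   of x_1. Hence Z<x_1,x_2>/M_3 is Z[x_1,x_2] + Z[x_1,x_2] u with the product
   f * g = f g - (df/dx_2) (dg/dx_1) u. In it the ideal of the relations meets the u-part, which is
   M_2/M_3, in the ideal generated by m x_1^(m-1), x_1^m, n x_2^(n-1), x_2^n, and the quotient can
   be read off monomial by monomial. The total number k of inversions, weighted by the coefficients
   of a noncommutative polynomial, is the isomorphism in each degree. *)

theory Submission
  imports Defs
begin

section \<open>The lower central series and its ideals under surjections and quotients\<close>

lemma (in ring) lower_central_subset: "lower_central R i \<subseteq> carrier R"
proof -
  have "lower_central R (Suc i) \<subseteq> carrier R" for i
  proof (induction i)
    case (Suc i)
    then have "{a \<otimes> l \<ominus> l \<otimes> a | a l. a \<in> carrier R \<and> l \<in> lower_central R (Suc i)} \<subseteq> carrier R"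
      by auto
    from add.generate_incl[simplified, OF this] show ?case
      by simp
  qed simp
  then show ?thesis
    by (cases i) simp_all
qed

text \<open>A homomorphism maps commutators to commutators and a generated additive subgroup onto
  the subgroup generated by the image; surjectivity makes every commutator of \<open>S\<close> arise
  in this way.\<close>

lemma lower_central_hom_image:
  assumes "ring_hom_ring R S h" and surj: "h ` carrier R = carrier S"
  shows "lower_central S i = h ` lower_central R i"
proof -
  interpret ring_hom_ring R S h by fact
  interpret add: group_hom "add_monoid R" "add_monoid S" h
    by (rule a_group_hom)
  note sub = R.lower_central_subset
  have "lower_central S (Suc i) = h ` lower_central R (Suc i)" for i
  proof (induction i)
    case (Suc i)
    let ?C = "{a \<otimes>\<^bsub>R\<^esub> l \<ominus>\<^bsub>R\<^esub> l \<otimes>\<^bsub>R\<^esub> a | a l. a \<in> carrier R \<and> l \<in> lower_central R (Suc i)}"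
    have hC: "h (a \<otimes>\<^bsub>R\<^esub> l \<ominus>\<^bsub>R\<^esub> l \<otimes>\<^bsub>R\<^esub> a) = h a \<otimes>\<^bsub>S\<^esub> h l \<ominus>\<^bsub>S\<^esub> h l \<otimes>\<^bsub>S\<^esub> h a"
      if "a \<in> carrier R" "l \<in> lower_central R (Suc i)" for a l
      using that sub by (simp add: a_minus_def subset_iff)
    have "?C \<subseteq> carrier R"
      using sub by auto
    then have "h ` generate (add_monoid R) ?C = generate (add_monoid S) (h ` ?C)"
      by (simp add: add.generate_img)
    moreover have "h ` ?C = {a \<otimes>\<^bsub>S\<^esub> l \<ominus>\<^bsub>S\<^esub> l \<otimes>\<^bsub>S\<^esub> a | a l. a \<in> carrier S \<and> l \<in> lower_central S (Suc i)}"
      unfolding Suc surj[symmetric] using hC by (auto simp: image_iff) (metis imageI)+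
    ultimately show ?case
      by simp
  qed (simp add: surj)
  then show ?thesis
    by (cases i) (simp_all add: surj)
qed

lemma (in ring) rcos_image_carrier: "(+>) I ` carrier R = carrier (R Quot I)"
  by (auto simp: FactRing_def A_RCOSETS_def')

text \<open>Both inclusions come from minimality of a generated ideal: the image of an ideal under
  the projection is an ideal, and so is the preimage of one. Hence \<open>M_i\<close> of a quotient
  can be studied in the ring above it.\<close>

lemma (in ring) lower_ideal_quotient:
  assumes "ideal I R"
  shows "lower_ideal (R Quot I) i = (+>) I ` lower_ideal R i"
proof -
  interpret I: ideal I R by fact
  interpret h: ring_hom_ring R "R Quot I" "(+>) I"
    by (rule I.rcos_ring_hom_ring)
  note L = lower_central_hom_image[OF h.ring_hom_ring_axioms rcos_image_carrier, of i]
  show ?thesis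
    unfolding lower_ideal_def
  proof (intro subset_antisym)
    have L_sub: "lower_central R i \<subseteq> carrier R"
      by (rule lower_central_subset)
    have "ideal ((+>) I ` (Idl lower_central R i)) (R Quot I)"
      using L_sub assms by (intro ring_ideal_imp_quot_ideal genideal_ideal)
    then show "Idl\<^bsub>R Quot I\<^esub> lower_central (R Quot I) i \<subseteq> (+>) I ` (Idl lower_central R i)"
      using genideal_self[OF L_sub] unfolding L by (intro h.S.genideal_minimal) auto
    have "lower_central (R Quot I) i \<subseteq> carrier (R Quot I)"
      by (rule h.S.lower_central_subset)
    then have "ideal (Idl\<^bsub>R Quot I\<^esub> lower_central (R Quot I) i) (R Quot I)"
      and "lower_central (R Quot I) i \<subseteq> Idl\<^bsub>R Quot I\<^esub> lower_central (R Quot I) i"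
      by (auto intro!: h.S.genideal_ideal h.S.genideal_self)
    then have "Idl lower_central R i
        \<subseteq> {r \<in> carrier R. I +> r \<in> Idl\<^bsub>R Quot I\<^esub> lower_central (R Quot I) i}"
      using L_sub unfolding L by (intro genideal_minimal h.ideal_vimage) auto
    then show "(+>) I ` (Idl lower_central R i) \<subseteq> Idl\<^bsub>R Quot I\<^esub> lower_central (R Quot I) i"
      by auto
  qed
qed

section \<open>Two-sided ideals and their congruences\<close>

text \<open>As \<open>-1\<close> is a ring element, closure under additive inverses is implied.\<close>

locale two_sided_ideal =
  fixes T :: "'a::ring_1 set"
  assumes zero_mem: "0 \<in> T"
    and add_mem: "f \<in> T \<Longrightarrow> g \<in> T \<Longrightarrow> f + g \<in> T"
    and mult_left_mem: "f \<in> T \<Longrightarrow> r * f \<in> T"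
    and mult_right_mem: "f \<in> T \<Longrightarrow> f * r \<in> T"
begin

lemma uminus_mem: "f \<in> T \<Longrightarrow> - f \<in> T"
  using mult_left_mem[of f "-1"] by simp

lemma diff_mem: "f \<in> T \<Longrightarrow> g \<in> T \<Longrightarrow> f - g \<in> T"
  using add_mem[of f "- g"] uminus_mem[of g] by simp

definition cong :: "'a \<Rightarrow> 'a \<Rightarrow> bool"  (infix "\<approx>" 50)
  where "f \<approx> g \<longleftrightarrow> f - g \<in> T"

lemma cong_refl: "f \<approx> f"
  by (simp add: cong_def zero_mem)

lemma cong_sym: "f \<approx> g \<Longrightarrow> g \<approx> f"
  using uminus_mem[of "f - g"] by (simp add: cong_def)

lemma cong_trans [trans]: "f \<approx> g \<Longrightarrow> g \<approx> h \<Longrightarrow> f \<approx> h"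
  using add_mem[of "f - g" "g - h"] by (simp add: cong_def)

lemma cong_diff: "f \<approx> g \<Longrightarrow> f' \<approx> g' \<Longrightarrow> f - f' \<approx> g - g'"
  using diff_mem[of "f - g" "f' - g'"] by (simp add: cong_def algebra_simps)

lemma cong_mult: "f \<approx> g \<Longrightarrow> f' \<approx> g' \<Longrightarrow> f * f' \<approx> g * g'"
  using add_mem[OF mult_right_mem[of "f - g" f'] mult_left_mem[of "f' - g'" g]]
  by (simp add: cong_def algebra_simps)

lemma cong_0_iff: "f \<approx> 0 \<longleftrightarrow> f \<in> T"
  by (simp add: cong_def)

end

section \<open>Calculation modulo an ideal containing all double commutators\<close>

text \<open>
  The multiples of \<open>modulus m n a b\<close> are the coefficients of the monomial of bidegree
  \<open>(a - 1, b - 1)\<close> in the ideal of \<open>\<int>[x, y]\<close> generated by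
  \<open>m x\<^sup>m\<^sup>-\<^sup>1, x\<^sup>m, n y\<^sup>n\<^sup>-\<^sup>1, y\<^sup>n\<close>.
\<close>

definition modulus :: "nat \<Rightarrow> nat \<Rightarrow> nat \<Rightarrow> nat \<Rightarrow> nat" where
  "modulus m n a b = (if m < a \<or> n < b then 1
     else gcd (if a = m then m else 0) (if b = n then n else 0))"

locale double_commutator_ideal = two_sided_ideal T for T :: "'a::ring_1 set" +
  fixes x y :: 'a
  assumes double_commutator_mem: "f * (g * h - h * g) - (g * h - h * g) * f \<in> T"
begin

definition comm :: 'a
  where "comm = x * y - y * x"

lemma comm_central: "f * comm \<approx> comm * f"
  unfolding comm_def cong_def by (rule double_commutator_mem)

text \<open>Since \<open>[xy, y] = [x, y] y\<close>, the derivation \<open>[x, -]\<close> takes it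
  to \<open>[x, [x, y]] y + [x, y]^2\<close>; so the square is a difference of elements of
  \<open>T\<close>.\<close>

lemma comm_square: "comm * comm \<approx> 0"
proof -
  have "comm * comm = (x * (x * y * y - y * (x * y)) - (x * y * y - y * (x * y)) * x)
     - (x * (x * y - y * x) - (x * y - y * x) * x) * y"
    unfolding comm_def by (simp add: algebra_simps)
  then show ?thesis
    unfolding cong_0_iff
    using double_commutator_mem[of x "x * y" y] mult_right_mem[OF double_commutator_mem[of x x y], of y]
    by (metis diff_mem)
qed

text \<open>Each of the \<open>a\<close> letters \<open>x\<close> that \<open>y\<close> passes
  leaves one factor \<open>-comm\<close>, which is central modulo \<open>T\<close>. The correction
  term is the derivative of \<open>x^a\<close> times \<open>comm\<close>.\<close>

lemma comm_left_power: "y * x ^ a \<approx> x ^ a * y - of_nat a * (x ^ (a - 1) * comm)"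
proof (induction a)
  case (Suc a)
  have "y * x ^ Suc a = x * (y * x ^ a) - comm * x ^ a"
    by (simp add: comm_def algebra_simps)
  also have "\<dots> \<approx> x * (x ^ a * y - of_nat a * (x ^ (a - 1) * comm)) - x ^ a * comm"
    by (intro cong_diff cong_mult cong_refl Suc.IH cong_sym[OF comm_central])
  also have "x * (of_nat a * (x ^ (a - 1) * comm)) = of_nat a * (x ^ a * comm)"
    by (cases a) (simp_all add: algebra_simps mult_of_nat_commute)
  then have "x * (x ^ a * y - of_nat a * (x ^ (a - 1) * comm)) - x ^ a * comm
      = x ^ Suc a * y - of_nat (Suc a) * (x ^ (Suc a - 1) * comm)"
    by (simp add: algebra_simps)
  finally show ?case .
qed (simp add: cong_refl)

lemma comm_right_power: "y ^ b * x \<approx> x * y ^ b - of_nat b * (comm * y ^ (b - 1))"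
proof (induction b)
  case (Suc b)
  have "y ^ Suc b * x = y ^ b * x * y - y ^ b * comm"
    by (simp add: comm_def algebra_simps power_Suc2 del: power_Suc)
  also have "\<dots> \<approx> (x * y ^ b - of_nat b * (comm * y ^ (b - 1))) * y - comm * y ^ b"
    by (intro cong_diff cong_mult cong_refl Suc.IH comm_central)
  also have "of_nat b * (comm * y ^ (b - 1)) * y = of_nat b * (comm * y ^ b)"
    by (cases b) (simp_all add: mult.assoc power_Suc2 del: power_Suc)
  then have "(x * y ^ b - of_nat b * (comm * y ^ (b - 1))) * y - comm * y ^ b
      = x * y ^ Suc b - of_nat (Suc b) * (comm * y ^ (Suc b - 1))"
    by (simp add: algebra_simps power_commutes)
  finally show ?case .
qed (simp add: cong_refl)

text \<open>The truncated subtraction is harmless: without inversions the coefficient of this term is 0.\<close>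

definition comm_monomial :: "nat \<Rightarrow> nat \<Rightarrow> 'a"
  where "comm_monomial a b = x ^ (a - 1) * comm * y ^ (b - 1)"

text \<open>Moving \<open>y\<close> past the power of \<open>x\<close> creates a second factor
  \<open>comm\<close>, and \<open>comm * comm\<close> vanishes modulo \<open>T\<close>; so
  \<open>y\<close> just joins the power on the right. For \<open>b = 0\<close> the truncated
  exponent \<open>b - 1\<close> would fail to count this \<open>y\<close>.\<close>

lemma mult_left_comm_monomial:
  assumes "0 < b"
  shows "y * comm_monomial a b \<approx> comm_monomial a (Suc b)"
proof -
  let ?a = "a - 1" and ?b = "b - 1"
  have "y * comm_monomial a b = y * x ^ ?a * (comm * y ^ ?b)"
    by (simp add: comm_monomial_def mult.assoc)
  also have "\<dots> \<approx> (x ^ ?a * y - of_nat ?a * (x ^ (?a - 1) * comm)) * (comm * y ^ ?b)"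
    by (intro cong_mult cong_refl comm_left_power)
  also have "\<dots> = x ^ ?a * (y * comm) * y ^ ?b - of_nat ?a * x ^ (?a - 1) * (comm * comm) * y ^ ?b"
    by (simp add: algebra_simps)
  also have "\<dots> \<approx> x ^ ?a * (comm * y) * y ^ ?b - of_nat ?a * x ^ (?a - 1) * 0 * y ^ ?b"
    by (intro cong_diff cong_mult cong_refl comm_central comm_square)
  also have "\<dots> = comm_monomial a (Suc b)"
    using assms by (cases b) (simp_all add: comm_monomial_def mult.assoc)
  finally show ?thesis .
qed

text \<open>As \<open>x^m\<close> lies in \<open>T\<close>, so does its commutator with
  \<open>y\<close>, which is \<open>m x^(m-1) comm\<close> up to sign and modulo \<open>T\<close>;
  likewise \<open>y^n\<close> and \<open>x\<close> give \<open>n comm y^(n-1)\<close>. Together with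
  \<open>x^m\<close> and \<open>y^n\<close> these account for all multiples described by
  \<open>modulus\<close>.\<close>

lemma int_multiple_comm_monomial:
  assumes "x ^ m \<in> T" "y ^ n \<in> T" "0 < a" "0 < b"
    and k: "int (modulus m n a b) dvd k"
  shows "of_int k * comm_monomial a b \<in> T"
proof -
  have pow_x: "x ^ (i - 1) \<in> T" if "m < i" for i
    using mult_right_mem[OF assms(1), of "x ^ (i - 1 - m)"] that by (simp flip: power_add)
  have pow_y: "y ^ (i - 1) \<in> T" if "n < i" for i
    using mult_right_mem[OF assms(2), of "y ^ (i - 1 - n)"] that by (simp flip: power_add)
  have zx: "of_nat m * comm_monomial a b \<in> T" if "a = m"
  proof -
    have "y * x ^ m - x ^ m * y + of_nat m * (x ^ (m - 1) * comm) \<in> T"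
      using comm_left_power[of m] by (simp add: cong_def algebra_simps)
    moreover have "y * x ^ m - x ^ m * y \<in> T"
      using assms(1) by (intro diff_mem mult_left_mem mult_right_mem)
    ultimately have "of_nat m * (x ^ (m - 1) * comm) \<in> T"
      using diff_mem by fastforce
    from mult_right_mem[OF this, of "y ^ (b - 1)"] show ?thesis
      by (simp add: comm_monomial_def that mult.assoc)
  qed
  have zy: "of_nat n * comm_monomial a b \<in> T" if "b = n"
  proof -
    have "y ^ n * x - x * y ^ n + of_nat n * (comm * y ^ (n - 1)) \<in> T"
      using comm_right_power[of n] by (simp add: cong_def algebra_simps)
    moreover have "y ^ n * x - x * y ^ n \<in> T"
      using assms(2) by (intro diff_mem mult_left_mem mult_right_mem)
    ultimately have "of_nat n * (comm * y ^ (n - 1)) \<in> T"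
      using diff_mem by fastforce
    from mult_left_mem[OF this, of "x ^ (a - 1)"] show ?thesis
      by (simp add: comm_monomial_def that mult.assoc mult_of_nat_commute)
  qed
  show ?thesis
  proof (cases "m < a \<or> n < b")
    case True
    then have "comm_monomial a b \<in> T"
      using pow_x pow_y unfolding comm_monomial_def
      by (auto intro: mult_left_mem mult_right_mem)
    then show ?thesis
      by (rule mult_left_mem)
  next
    case False
    let ?p = "if a = m then m else 0" and ?q = "if b = n then n else 0"
    \<comment> \<open>In the corner \<open>a = m\<close>, \<open>b = n\<close> the two known
      multiples combine to their gcd. Elsewhere at least one of \<open>?p\<close>, \<open>?q\<close>
      is 0, and if both are, then \<open>k = 0\<close>.\<close>
    obtain s t where st: "s * int ?p + t * int ?q = gcd (int ?p) (int ?q)"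
      using bezout_int by blast
    obtain c where "k = c * gcd (int ?p) (int ?q)"
      using k False by (auto simp: modulus_def dvd_def mult.commute simp flip: gcd_int_int_eq)
    then have "of_int k * comm_monomial a b
        = of_int (c * s) * (of_nat ?p * comm_monomial a b) + of_int (c * t) * (of_nat ?q * comm_monomial a b)"
      unfolding st[symmetric] by (simp add: algebra_simps)
    moreover have "of_nat ?p * comm_monomial a b \<in> T" "of_nat ?q * comm_monomial a b \<in> T"
      using zx zy by (auto simp: zero_mem)
    ultimately show ?thesis
      by (metis add_mem mult_left_mem)
  qed
qed

end


section \<open>Inversions and bidegrees of words\<close>

fun inversions :: "two list \<Rightarrow> nat" where
  "inversions [] = 0"
| "inversions (X1 # l) = inversions l"
| "inversions (X2 # l) = count_list l X1 + inversions l"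

text \<open>The product term counts the inversions between the two factors: any \<open>X2\<close> of
  \<open>l\<close> with any \<open>X1\<close> of \<open>l'\<close>.\<close>

lemma inversions_append:
  "inversions (l @ l') = inversions l + inversions l' + count_list l X2 * count_list l' X1"
  by (induction l rule: inversions.induct) (simp_all add: algebra_simps)

lemma inversions_replicate [simp]: "inversions (replicate k v) = 0"
  by (induction k) (cases v; simp)+

lemma inversions_eq_0: "count_list l X1 = 0 \<or> count_list l X2 = 0 \<Longrightarrow> inversions l = 0"
  by (induction l rule: inversions.induct) auto

definition bidegree :: "two free_monoid \<Rightarrow> nat \<times> nat" where
  "bidegree w = (count_list (letters w) X1, count_list (letters w) X2)"

lemma bidegree_Word_simps [simp]:
  "bidegree (Word [X1] + w) = (Suc (fst (bidegree w)), snd (bidegree w))"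
  "bidegree (Word [X2] + w) = (fst (bidegree w), Suc (snd (bidegree w)))"
  "bidegree (w + Word [X1]) = (Suc (fst (bidegree w)), snd (bidegree w))"
  "bidegree (w + Word [X2]) = (fst (bidegree w), Suc (snd (bidegree w)))"
  by (simp_all add: bidegree_def plus_free_monoid_def)

lemma bidegree_add:
  "bidegree (v + w) = (fst (bidegree v) + fst (bidegree w), snd (bidegree v) + snd (bidegree w))"
  by (simp add: bidegree_def plus_free_monoid_def)

section \<open>Additive functionals on the free ring: coefficient sums and inversion sums\<close>

lemma free_ring_induct [case_names word diff]:
  fixes f :: "'v free_monoid \<Rightarrow>\<^sub>0 int"
  assumes "\<And>w. P (frag_of w)" "\<And>f g. P f \<Longrightarrow> P g \<Longrightarrow> P (f - g)"
  shows "P f"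
  by (rule frag_induction[of f UNIV])
    \<comment> \<open>The zero element is a difference of a word with itself; any word
      serves.\<close>
    (use assms(2)[OF assms(1) assms(1), of undefined undefined] assms in auto)

definition linear_extension :: "('w \<Rightarrow> int) \<Rightarrow> ('w \<Rightarrow>\<^sub>0 int) \<Rightarrow> int" where
  "linear_extension \<phi> f = (\<Sum>w\<in>Poly_Mapping.keys f. Poly_Mapping.lookup f w * \<phi> w)"

lemma linear_extension_0 [simp]: "linear_extension \<phi> 0 = 0"
  by (simp add: linear_extension_def)

lemma linear_extension_frag_of [simp]: "linear_extension \<phi> (frag_of w) = \<phi> w"
  by (simp add: linear_extension_def)

lemma linear_extension_add:
  "linear_extension \<phi> (f + g) = linear_extension \<phi> f + linear_extension \<phi> g"
  unfolding linear_extension_def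
  by (rule setsum_keys_plus_distrib) (simp_all add: algebra_simps)

lemma linear_extension_diff:
  "linear_extension \<phi> (f - g) = linear_extension \<phi> f - linear_extension \<phi> g"
  using linear_extension_add[of \<phi> "f - g" g] by simp

lemma linear_extension_combination:
  "linear_extension (\<lambda>w. \<phi> w + c * \<psi> w) f = linear_extension \<phi> f + c * linear_extension \<psi> f"
  by (simp add: linear_extension_def algebra_simps sum.distrib sum_distrib_left)

lemma linear_extension_of_int_mult:
  fixes f :: "'v free_monoid \<Rightarrow>\<^sub>0 int"
  shows "linear_extension \<phi> (of_int k * f) = k * linear_extension \<phi> f"
proof -
  have nat: "linear_extension \<phi> (of_nat i * f) = int i * linear_extension \<phi> f" for i
    by (induction i) (simp_all add: algebra_simps linear_extension_add)
  show ?thesis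
    by (cases k rule: int_diff_cases) (simp only: of_int_diff of_int_of_nat_eq left_diff_distrib linear_extension_diff nat)
qed

lemma linear_extension_mult_left:
  fixes f :: "'v free_monoid \<Rightarrow>\<^sub>0 int"
  shows "linear_extension \<phi> (frag_of v * f) = linear_extension (\<lambda>w. \<phi> (v + w)) f"
  by (induction f rule: free_ring_induct)
    (simp_all add: right_diff_distrib linear_extension_diff mult_single)

lemma linear_extension_mult_right:
  fixes f :: "'v free_monoid \<Rightarrow>\<^sub>0 int"
  shows "linear_extension \<phi> (f * frag_of v) = linear_extension (\<lambda>w. \<phi> (w + v)) f"
  by (induction f rule: free_ring_induct)
    (simp_all add: left_diff_distrib linear_extension_diff mult_single)

text \<open>Such a functional is a trace: by additivity in both arguments it is enough to compare
  \<open>vw\<close> with \<open>wv\<close> for words.\<close>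

lemma linear_extension_commutator:
  fixes g h :: "'v free_monoid \<Rightarrow>\<^sub>0 int"
  assumes "\<And>v w. \<phi> (v + w) = \<phi> (w + v)"
  shows "linear_extension \<phi> (g * h - h * g) = 0"
proof (induction g rule: free_ring_induct)
  case (word v)
  show ?case
    by (simp add: linear_extension_diff linear_extension_mult_left linear_extension_mult_right
        assms[of v])
next
  case (diff f g)
  have "(f - g) * h - h * (f - g) = (f * h - h * f) - (g * h - h * g)"
    by (simp add: algebra_simps)
  then show ?case
    using diff by (simp only: linear_extension_diff)
qed

text \<open>The hypothesis says that \<open>\<phi>\<close> vanishes on
  \<open>[u, [v, w]] = uvw - uwv - vwu + wvu\<close> for words; the double commutator is additive in
  each of its three arguments.\<close>

lemma linear_extension_double_commutator:
  fixes f g h :: "'v free_monoid \<Rightarrow>\<^sub>0 int"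
  assumes "\<And>u v w. \<phi> (u + v + w) + \<phi> (w + v + u) = \<phi> (u + w + v) + \<phi> (v + w + u)"
  shows "linear_extension \<phi> (f * (g * h - h * g) - (g * h - h * g) * f) = 0"
proof (induction f rule: free_ring_induct)
  case (word u)
  show ?case
  proof (induction g rule: free_ring_induct)
    case (word v)
    show ?case
    proof (induction h rule: free_ring_induct)
      case (word w)
      then show ?case
        using assms[of u v w] by (simp add: algebra_simps mult_single linear_extension_diff linear_extension_add)
    next
      case (diff f g)
      have "frag_of u * (frag_of v * (f - g) - (f - g) * frag_of v) - (frag_of v * (f - g) - (f - g) * frag_of v) * frag_of u
         = (frag_of u * (frag_of v * f - f * frag_of v) - (frag_of v * f - f * frag_of v) * frag_of u)
         - (frag_of u * (frag_of v * g - g * frag_of v) - (frag_of v * g - g * frag_of v) * frag_of u)"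
        by (simp add: algebra_simps)
      then show ?case
        using diff by (simp only: linear_extension_diff)
    qed
  next
    case (diff f g)
    have "frag_of u * ((f - g) * h - h * (f - g)) - ((f - g) * h - h * (f - g)) * frag_of u
         = (frag_of u * (f * h - h * f) - (f * h - h * f) * frag_of u)
         - (frag_of u * (g * h - h * g) - (g * h - h * g) * frag_of u)"
      by (simp add: algebra_simps)
    then show ?case
      using diff by (simp only: linear_extension_diff)
  qed
next
  case (diff f f')
  have "(f - f') * (g * h - h * g) - (g * h - h * g) * (f - f')
      = (f * (g * h - h * g) - (g * h - h * g) * f) - (f' * (g * h - h * g) - (g * h - h * g) * f')"
    by (simp add: algebra_simps)
  then show ?case
    using diff by (simp only: linear_extension_diff)
qed

text \<open>This is the coefficient of \<open>x_1^a x_2^b\<close> in the image of the polynomial in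
  the commutative ring \<open>\<int>[x_1, x_2]\<close>.\<close>

definition coeff_sum :: "nat \<Rightarrow> nat \<Rightarrow> free_ring2 \<Rightarrow> int" where
  "coeff_sum a b = linear_extension (\<lambda>w. if bidegree w = (a, b) then 1 else 0)"

text \<open>For positive \<open>a\<close> and \<open>b\<close> this is, up to sign, the coefficient
  of \<open>x_1^(a-1) u x_2^(b-1)\<close> in the normal form modulo \<open>M_3\<close>.\<close>

definition inversion_sum :: "nat \<Rightarrow> nat \<Rightarrow> free_ring2 \<Rightarrow> int" where
  "inversion_sum a b =
     linear_extension (\<lambda>w. if bidegree w = (a, b) then int (inversions (letters w)) else 0)"

lemma coeff_sum_diff: "coeff_sum a b (f - g) = coeff_sum a b f - coeff_sum a b g"
  and inversion_sum_diff: "inversion_sum a b (f - g) = inversion_sum a b f - inversion_sum a b g"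
  and inversion_sum_add: "inversion_sum a b (f + g) = inversion_sum a b f + inversion_sum a b g"
  and inversion_sum_of_int_mult: "inversion_sum a b (of_int k * f) = k * inversion_sum a b f"
  by (simp_all add: coeff_sum_def inversion_sum_def linear_extension_diff linear_extension_add
      linear_extension_of_int_mult)

lemma inversion_sum_eq_0: "a = 0 \<or> b = 0 \<Longrightarrow> inversion_sum a b f = 0"
  by (auto simp: inversion_sum_def linear_extension_def bidegree_def inversions_eq_0 intro!: sum.neutral)

lemma coeff_sum_mult_gen [simp]:
  "coeff_sum 0 b (gen X1 * f) = 0" "coeff_sum (Suc a) b (gen X1 * f) = coeff_sum a b f"
  "coeff_sum a 0 (gen X2 * f) = 0" "coeff_sum a (Suc b) (gen X2 * f) = coeff_sum a b f"
  "coeff_sum 0 b (f * gen X1) = 0" "coeff_sum (Suc a) b (f * gen X1) = coeff_sum a b f"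
  "coeff_sum a 0 (f * gen X2) = 0" "coeff_sum a (Suc b) (f * gen X2) = coeff_sum a b f"
  unfolding coeff_sum_def gen_def linear_extension_mult_left linear_extension_mult_right
  by (simp_all add: prod_eq_iff linear_extension_def)

text \<open>A letter \<open>X2\<close> put before a word with \<open>a\<close> letters
  \<open>X1\<close> adds \<open>a\<close> inversions, and a letter \<open>X1\<close> put after
  \<open>b\<close> letters \<open>X2\<close> adds \<open>b\<close>; the other two multiplications
  add none. The extra terms are the partial derivatives in the twisted product.\<close>

lemma inversion_sum_mult_gen [simp]:
  "inversion_sum 0 b (gen X1 * f) = 0"
  "inversion_sum (Suc a) b (gen X1 * f) = inversion_sum a b f"
  "inversion_sum a 0 (gen X2 * f) = 0"
  "inversion_sum a (Suc b) (gen X2 * f) = inversion_sum a b f + int a * coeff_sum a b f"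
  "inversion_sum 0 b (f * gen X1) = 0"
  "inversion_sum (Suc a) b (f * gen X1) = inversion_sum a b f + int b * coeff_sum a b f"
  "inversion_sum a 0 (f * gen X2) = 0"
  "inversion_sum a (Suc b) (f * gen X2) = inversion_sum a b f"
  unfolding coeff_sum_def inversion_sum_def gen_def
    linear_extension_mult_left linear_extension_mult_right linear_extension_combination[symmetric]
  by (simp_all add: prod_eq_iff linear_extension_def, unfold bidegree_def plus_free_monoid_def)
    (auto simp: inversions_append intro!: sum.cong)

lemma coeff_sum_commutator: "coeff_sum a b (g * h - h * g) = 0"
  unfolding coeff_sum_def
  by (rule linear_extension_commutator) (auto simp: bidegree_add add.commute)

lemma coeff_sum_double_commutator:
  "coeff_sum a b (f * (g * h - h * g) - (g * h - h * g) * f) = 0"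
  by (rule coeff_sum_commutator)

text \<open>Inversions of a threefold product are those inside the factors plus those between pairs
  of factors, and the latter depend only on the order within each pair. Among
  \<open>uvw, wvu\<close> each pair occurs once in each order, and the same holds among
  \<open>uwv, vwu\<close>.\<close>

lemma inversion_sum_double_commutator:
  "inversion_sum a b (f * (g * h - h * g) - (g * h - h * g) * f) = 0"
  unfolding inversion_sum_def
proof (rule linear_extension_double_commutator)
  fix u v w :: "two free_monoid"
  have "bidegree (u + v + w) = bidegree (w + v + u)" "bidegree (u + v + w) = bidegree (u + w + v)"
    "bidegree (u + v + w) = bidegree (v + w + u)"
    by (simp_all add: bidegree_add)
  then show "(if bidegree (u + v + w) = (a, b) then int (inversions (letters (u + v + w))) else 0) +
       (if bidegree (w + v + u) = (a, b) then int (inversions (letters (w + v + u))) else 0) =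
       (if bidegree (u + w + v) = (a, b) then int (inversions (letters (u + w + v))) else 0) +
       (if bidegree (v + w + u) = (a, b) then int (inversions (letters (v + w + u))) else 0)"
    by (simp add: plus_free_monoid_def inversions_append algebra_simps)
qed

section \<open>The model of the ideal of the relations\<close>

lemma two_sided_ideal_of_gen_closed:
  fixes T :: "free_ring2 set"
  assumes zero: "0 \<in> T" and diff: "\<And>f g. f \<in> T \<Longrightarrow> g \<in> T \<Longrightarrow> f - g \<in> T"
    and left: "\<And>v f. f \<in> T \<Longrightarrow> gen v * f \<in> T" and right: "\<And>v f. f \<in> T \<Longrightarrow> f * gen v \<in> T"
  shows "two_sided_ideal T"
proof
  have cons: "frag_of (Word (v # l)) = gen v * frag_of (Word l)" for v l
    by (simp add: gen_def mult_single plus_free_monoid_def)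
  have one: "frag_of (Word []) = (1 :: free_ring2)"
    by (simp flip: zero_free_monoid_def)
  fix f r assume f: "f \<in> T"
  have "frag_of (Word l) * f \<in> T" for l
    by (induction l) (simp_all add: f one cons mult.assoc left)
  \<comment> \<open>Here \<open>f\<close> must vary in the induction, as the first letter of the
    word is absorbed into it.\<close>
  moreover have "f * frag_of (Word l) \<in> T" for l
    using f by (induction l arbitrary: f) (simp_all add: one cons right flip: mult.assoc)
  ultimately show "r * f \<in> T" "f * r \<in> T"
    by (induction r rule: free_ring_induct; metis free_monoid.exhaust diff left_diff_distrib right_diff_distrib)+
next
  fix f g assume "f \<in> T" "g \<in> T"
  then show "f + g \<in> T"
    using diff[OF \<open>f \<in> T\<close> diff[OF zero \<open>g \<in> T\<close>]] by simp
qed (fact zero)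

lemma gen_power: "gen v ^ k = frag_of (Word (replicate k v))"
  by (induction k) (simp_all add: gen_def mult_single plus_free_monoid_def flip: zero_free_monoid_def)

lemma count_list_replicate: "count_list (replicate k v) w = (if v = w then k else 0)"
  by (induction k) auto

text \<open>The coefficient condition is thus stable under multiplication by a variable, as it must
  be for an ideal of \<open>\<int>[x, y]\<close>.\<close>

lemma modulus_Suc_dvd: "modulus m n (Suc a) b dvd modulus m n a b" "modulus m n a (Suc b) dvd modulus m n a b"
  by (auto simp: modulus_def)

text \<open>
  In \<open>\<int>[x, y] \<oplus> \<int>[x, y] u\<close> this is the ideal of all \<open>p + q u\<close> with \<open>p \<in> (x\<^sup>m, y\<^sup>n)\<close>
  and \<open>q \<in> (m x\<^sup>m\<^sup>-\<^sup>1, x\<^sup>m, n y\<^sup>n\<^sup>-\<^sup>1, y\<^sup>n)\<close>.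
\<close>

definition model_ideal :: "nat \<Rightarrow> nat \<Rightarrow> free_ring2 set" where
  "model_ideal m n = {f. \<forall>a b. (a < m \<and> b < n \<longrightarrow> coeff_sum a b f = 0) \<and>
     int (modulus m n a b) dvd inversion_sum a b f}"

text \<open>This is the preimage of the ideal \<open>(x^m, y^n)\<close> of
  \<open>\<int>[x, y]\<close>. It contains all commutators and so bounds \<open>M_2\<close> from
  above, as \<open>model_ideal\<close> bounds \<open>M_3\<close>.\<close>

lemma two_sided_ideal_coeff_sum:
  "two_sided_ideal {f. \<forall>a b. a < m \<and> b < n \<longrightarrow> coeff_sum a b f = 0}"
proof (rule two_sided_ideal_of_gen_closed, safe)
  fix f a b v
  assume f: "\<forall>a b. a < m \<and> b < n \<longrightarrow> coeff_sum a b f = 0" and ab: "a < m" "b < n"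
  show "coeff_sum a b (gen v * f) = 0" "coeff_sum a b (f * gen v) = 0"
    using f ab by (cases v; cases a; cases b; simp)+
qed (auto simp: coeff_sum_diff, simp add: coeff_sum_def)

lemma two_sided_ideal_model_ideal: "two_sided_ideal (model_ideal m n)"
proof (rule two_sided_ideal_of_gen_closed)
  show "0 \<in> model_ideal m n"
    by (simp add: model_ideal_def coeff_sum_def inversion_sum_def)
  show "f - g \<in> model_ideal m n" if "f \<in> model_ideal m n" "g \<in> model_ideal m n" for f g
    using that by (auto simp: model_ideal_def coeff_sum_diff inversion_sum_diff)
  fix f assume f: "f \<in> model_ideal m n"
  have E: "coeff_sum a b f = 0" if "a < m" "b < n" for a b
    using f that by (simp add: model_ideal_def)
  have K: "int (modulus m n (Suc a) b) dvd inversion_sum a b f"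
    "int (modulus m n a (Suc b)) dvd inversion_sum a b f" for a b
    using f modulus_Suc_dvd[of m n a b] dvd_trans of_nat_dvd_iff unfolding model_ideal_def by blast+
  \<comment> \<open>Outside the range where the coefficient sum vanishes, the modulus is 1 or
    \<open>a = m\<close>; in the latter case it divides \<open>m\<close>, hence the factor
    \<open>a\<close>. The next fact is symmetric.\<close>
  have y: "int (modulus m n a (Suc b)) dvd int a * coeff_sum a b f" for a b
    using E[of a b] by (cases "a < m \<and> b < n") (auto simp: modulus_def intro: dvd_mult2)
  have x: "int (modulus m n (Suc a) b) dvd int b * coeff_sum a b f" for a b
    using E[of a b] by (cases "a < m \<and> b < n") (auto simp: modulus_def intro: dvd_mult2)
  note Ky = dvd_add[OF K(2) y] and Kx = dvd_add[OF K(1) x]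
  show "gen v * f \<in> model_ideal m n" "f * gen v \<in> model_ideal m n" for v
    unfolding model_ideal_def
  proof (safe)
    fix a b assume "a < m" "b < n"
    then show "coeff_sum a b (gen v * f) = 0" "coeff_sum a b (f * gen v) = 0"
      by (cases v; cases a; cases b; simp add: E)+
  next
    fix a b
    show "int (modulus m n a b) dvd inversion_sum a b (gen v * f)"
      "int (modulus m n a b) dvd inversion_sum a b (f * gen v)"
      by (cases v; cases a; cases b; simp only: inversion_sum_mult_gen dvd_0_right K Ky Kx)+
  qed
qed

lemma double_commutator_in_model_ideal: "f * (g * h - h * g) - (g * h - h * g) * f \<in> model_ideal m n"
  by (simp add: model_ideal_def coeff_sum_double_commutator inversion_sum_double_commutator)

lemma gen_power_in_model_ideal: "gen X1 ^ m \<in> model_ideal m n" "gen X2 ^ n \<in> model_ideal m n"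
  by (auto simp: model_ideal_def gen_power coeff_sum_def inversion_sum_def bidegree_def count_list_replicate)

section \<open>Normal forms modulo double commutators\<close>

locale free_double_commutator_ideal =
  double_commutator_ideal T "gen X1" "gen X2"
  for T
begin

text \<open>Induction on the first letter: \<open>X1\<close> simply joins the power on the left,
  while \<open>X2\<close> has to pass all \<open>count_list l X1\<close> letters and leaves one
  factor \<open>comm\<close> for each, exactly the number of new inversions.\<close>

lemma word_cong:
  "frag_of (Word l) \<approx> gen X1 ^ count_list l X1 * gen X2 ^ count_list l X2
     - of_nat (inversions l) * comm_monomial (count_list l X1) (count_list l X2)"
proof (induction l)
  case Nil
  then show ?case
    by (simp add: cong_refl flip: zero_free_monoid_def)
next
  case (Cons v l)
  let ?a = "count_list l X1" and ?b = "count_list l X2" and ?i = "inversions l"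
  have swap: "gen v * (of_nat ?i * f) = of_nat ?i * (gen v * f)" for f
    by (metis mult.assoc mult_of_nat_commute)
  have "frag_of (Word (v # l)) = gen v * frag_of (Word l)"
    by (simp add: gen_def mult_single plus_free_monoid_def)
  also have "\<dots> \<approx> gen v * (gen X1 ^ ?a * gen X2 ^ ?b - of_nat ?i * comm_monomial ?a ?b)"
    by (intro cong_mult cong_refl Cons.IH)
  finally have IH: "frag_of (Word (v # l)) \<approx>
    gen v * (gen X1 ^ ?a * gen X2 ^ ?b) - of_nat ?i * (gen v * comm_monomial ?a ?b)"
    by (simp only: right_diff_distrib swap)
  show ?case
  proof (cases v)
    case X1
    have "of_nat ?i * (gen X1 * comm_monomial ?a ?b) = of_nat ?i * comm_monomial (Suc ?a) ?b"
    \<comment> \<open>Without a letter \<open>X1\<close> the truncated exponent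
      \<open>?a - 1\<close> spoils the identity of the monomials, but then the coefficient
      \<open>?i\<close> is 0.\<close>
    proof (cases "?a = 0")
      case False
      then show ?thesis
        by (cases ?a) (simp_all add: comm_monomial_def mult.assoc)
    qed (simp add: inversions_eq_0)
    with IH X1 show ?thesis
      by (simp add: mult.assoc)
  next
    case X2
    have "of_nat ?i * (gen X2 * comm_monomial ?a ?b) \<approx> of_nat ?i * comm_monomial ?a (Suc ?b)"
    proof (cases "?b = 0")
      case False
      then show ?thesis
        by (intro cong_mult cong_refl mult_left_comm_monomial) simp
    qed (simp add: inversions_eq_0 cong_refl)
    moreover have "gen X2 * (gen X1 ^ ?a * gen X2 ^ ?b) \<approx>
        (gen X1 ^ ?a * gen X2 - of_nat ?a * (gen X1 ^ (?a - 1) * comm)) * gen X2 ^ ?b"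
      using cong_mult[OF comm_left_power cong_refl] by (simp add: mult.assoc)
    moreover have "(gen X1 ^ ?a * gen X2 - of_nat ?a * (gen X1 ^ (?a - 1) * comm)) * gen X2 ^ ?b
        = gen X1 ^ ?a * gen X2 ^ Suc ?b - of_nat ?a * comm_monomial ?a (Suc ?b)"
      by (simp add: left_diff_distrib comm_monomial_def mult.assoc)
    ultimately have "gen X2 * (gen X1 ^ ?a * gen X2 ^ ?b) - of_nat ?i * (gen X2 * comm_monomial ?a ?b) \<approx>
        gen X1 ^ ?a * gen X2 ^ Suc ?b - of_nat ?a * comm_monomial ?a (Suc ?b) - of_nat ?i * comm_monomial ?a (Suc ?b)"
      by (metis cong_diff)
    from cong_trans[OF IH[unfolded X2] this] show ?thesis
      by (simp add: X2 algebra_simps)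
  qed
qed

text \<open>All words of one bidegree have the same two monomials in their normal forms, so only the
  coefficients are summed.\<close>

lemma bihomogeneous_cong:
  assumes "f \<in> bihomogeneous a b"
  shows "f \<approx> of_int (coeff_sum a b f) * (gen X1 ^ a * gen X2 ^ b) - of_int (inversion_sum a b f) * comm_monomial a b"
proof -
  have "Poly_Mapping.keys f \<subseteq> {w. bidegree w = (a, b)}"
    using assms by (auto simp: bihomogeneous_def bidegree_def)
  then show ?thesis
  proof (induction f rule: frag_induction)
    case zero
    then show ?case
      by (simp add: coeff_sum_def inversion_sum_def cong_refl)
  next
    case (one w)
    then show ?case
      using word_cong[of "letters w"] by (auto simp: coeff_sum_def inversion_sum_def bidegree_def)
  next
    case (diff f g)
    show ?case
      using cong_diff[OF diff] by (simp add: coeff_sum_diff inversion_sum_diff algebra_simps)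
  qed
qed

end

section \<open>The second and third ideals of the free ring\<close>

lemma Free2_simps [simp]:
  "carrier Free2 = UNIV" "f \<otimes>\<^bsub>Free2\<^esub> g = f * g" "f \<oplus>\<^bsub>Free2\<^esub> g = f + g"
  "\<zero>\<^bsub>Free2\<^esub> = 0" "\<one>\<^bsub>Free2\<^esub> = 1"
  by (simp_all add: ring_of_type_algebra_def)

lemma Free2_uminus [simp]: "\<ominus>\<^bsub>Free2\<^esub> f = - f"
proof -
  interpret ring Free2
    by (rule ring_Free2)
  show ?thesis
    by (rule minus_equality) simp_all
qed

lemma Free2_minus [simp]: "f \<ominus>\<^bsub>Free2\<^esub> g = f - g"
  by (simp add: a_minus_def)

lemma ideal_Free2_iff: "ideal T Free2 \<longleftrightarrow> two_sided_ideal T"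
proof
  assume "ideal T Free2"
  then interpret ideal T Free2 .
  show "two_sided_ideal T"
    using additive_subgroup.zero_closed[OF is_additive_subgroup]
      additive_subgroup.a_closed[OF is_additive_subgroup] I_l_closed I_r_closed
    by unfold_locales simp_all
next
  assume "two_sided_ideal T"
  then interpret two_sided_ideal T .
  show "ideal T Free2"
  proof (intro idealI ring_Free2 group.subgroupI)
    show "Group.group (add_monoid Free2)"
      by (rule abelian_group.a_group[OF ring.is_abelian_group[OF ring_Free2]])
    show "inv\<^bsub>add_monoid Free2\<^esub> f \<in> T" if "f \<in> T" for f
      using that by (metis Free2_uminus a_inv_def uminus_mem)
    show "T \<noteq> {}"
      using zero_mem by blast
  qed (simp_all add: add_mem mult_left_mem mult_right_mem)
qed

lemma lower_central_2: "lower_central A 2 = generate (add_monoid A)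
    {f \<otimes>\<^bsub>A\<^esub> g \<ominus>\<^bsub>A\<^esub> g \<otimes>\<^bsub>A\<^esub> f | f g. f \<in> carrier A \<and> g \<in> carrier A}"
  by (simp add: numeral_2_eq_2)

lemma lower_central_3: "lower_central A 3 = generate (add_monoid A)
    {f \<otimes>\<^bsub>A\<^esub> g \<ominus>\<^bsub>A\<^esub> g \<otimes>\<^bsub>A\<^esub> f | f g. f \<in> carrier A \<and> g \<in> lower_central A 2}"
  by (simp add: numeral_2_eq_2 numeral_3_eq_3)

lemma lower_central_le_lower_ideal_Free2: "lower_central Free2 i \<subseteq> lower_ideal Free2 i"
  unfolding lower_ideal_def by (simp add: ring.genideal_self ring_Free2)

lemma commutator_in_lower_ideal: "g * h - h * g \<in> lower_ideal Free2 2"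
  by (rule subsetD[OF lower_central_le_lower_ideal_Free2])
    (auto simp: lower_central_2 intro!: generate.incl)

lemma double_commutator_in_lower_ideal:
  "f * (g * h - h * g) - (g * h - h * g) * f \<in> lower_ideal Free2 3"
proof (rule subsetD[OF lower_central_le_lower_ideal_Free2])
  have "g * h - h * g \<in> lower_central Free2 2"
    by (auto simp: lower_central_2 intro!: generate.incl)
  then show "f * (g * h - h * g) - (g * h - h * g) * f \<in> lower_central Free2 3"
    unfolding lower_central_3 by (intro generate.incl) force
qed

lemma generate_Free2_induct [consumes 1, case_names zero incl diff]:
  assumes "f \<in> generate (add_monoid Free2) C"
    and "P 0" "\<And>f. f \<in> C \<Longrightarrow> P f" "\<And>f g. P f \<Longrightarrow> P g \<Longrightarrow> P (f - g)"
  shows "P f"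
  using assms(1)
proof (induction f rule: generate.induct)
  case (inv h)
  then show ?case
    using assms(4)[OF assms(2) assms(3)[of h]] by (metis Free2_uminus a_inv_def diff_0)
next
  case (eng f g)
  then show ?case
    using assms(4)[OF eng(3) assms(4)[OF assms(2) eng(4)]] by simp
qed (simp_all add: assms)

lemma lower_ideal_2_minimal:
  assumes "two_sided_ideal T" "\<And>g h. g * h - h * g \<in> T"
  shows "lower_ideal Free2 2 \<subseteq> T"
proof -
  interpret two_sided_ideal T by fact
  have "lower_central Free2 2 \<subseteq> T"
  proof
    fix f assume "f \<in> lower_central Free2 2"
    then show "f \<in> T"
      unfolding lower_central_2
      by (induction f rule: generate_Free2_induct) (auto simp: zero_mem assms diff_mem)
  qed
  then show ?thesis
    unfolding lower_ideal_def
    using assms by (simp add: ring.genideal_minimal ring_Free2 ideal_Free2_iff)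
qed

text \<open>The map taking \<open>l\<close> to \<open>[f, l]\<close> is additive, so on the additive
  span \<open>L_2\<close> it is controlled by its values on single commutators.\<close>

lemma lower_ideal_3_minimal:
  assumes "two_sided_ideal T" "\<And>f g h. f * (g * h - h * g) - (g * h - h * g) * f \<in> T"
  shows "lower_ideal Free2 3 \<subseteq> T"
proof -
  interpret two_sided_ideal T by fact
  have L2: "f * l - l * f \<in> T" if "l \<in> lower_central Free2 2" for f l
    using that unfolding lower_central_2
  proof (induction l rule: generate_Free2_induct)
    case (diff g h)
    have "f * (g - h) - (g - h) * f = (f * g - g * f) - (f * h - h * f)"
      by (simp add: algebra_simps)
    then show ?case
      using diff diff_mem by metis
  qed (auto simp: zero_mem assms)
  have "lower_central Free2 3 \<subseteq> T"
  proof
    fix f assume "f \<in> lower_central Free2 3"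
    then show "f \<in> T"
      unfolding lower_central_3
      by (induction f rule: generate_Free2_induct) (auto simp: zero_mem L2 diff_mem)
  qed
  then show ?thesis
    unfolding lower_ideal_def
    using assms by (simp add: ring.genideal_minimal ring_Free2 ideal_Free2_iff)
qed

section \<open>Assembly of the isomorphism\<close>

lemma iso_of_equal_fibres:
  assumes "\<pi> ` D = carrier G" "\<rho> ` D = carrier H"
    and "\<And>f g. f \<in> D \<Longrightarrow> g \<in> D \<Longrightarrow> f + g \<in> D"
    and "\<And>f g. f \<in> D \<Longrightarrow> g \<in> D \<Longrightarrow> \<pi> (f + g) = \<pi> f \<otimes>\<^bsub>G\<^esub> \<pi> g"
    and "\<And>f g. f \<in> D \<Longrightarrow> g \<in> D \<Longrightarrow> \<rho> (f + g) = \<rho> f \<otimes>\<^bsub>H\<^esub> \<rho> g"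
    and fibres: "\<And>f g. f \<in> D \<Longrightarrow> g \<in> D \<Longrightarrow> \<pi> f = \<pi> g \<longleftrightarrow> \<rho> f = \<rho> g"
  shows "G \<cong> H"
proof -
  \<comment> \<open>An arbitrary preimage under \<open>\<pi>\<close> is chosen; equality of the
    fibres makes the value independent of the choice.\<close>
  define \<theta> where "\<theta> = \<rho> \<circ> inv_into D \<pi>"
  have \<theta>: "\<theta> (\<pi> f) = \<rho> f" if "f \<in> D" for f
    using that fibres[of "inv_into D \<pi> (\<pi> f)" f]
    by (simp add: \<theta>_def inv_into_into f_inv_into_f)
  have "\<theta> \<in> hom G H"
  proof (rule homI)
    fix c assume "c \<in> carrier G"
    then obtain f where f: "f \<in> D" "c = \<pi> f"
      using assms(1) by blast
    then show "\<theta> c \<in> carrier H"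
      using assms(2) by (auto simp: \<theta>)
    fix c' assume "c' \<in> carrier G"
    then obtain g where g: "g \<in> D" "c' = \<pi> g"
      using assms(1) by blast
    from f g have "\<theta> (c \<otimes>\<^bsub>G\<^esub> c') = \<theta> (\<pi> (f + g))"
      by (simp add: assms(4))
    with f g show "\<theta> (c \<otimes>\<^bsub>G\<^esub> c') = \<theta> c \<otimes>\<^bsub>H\<^esub> \<theta> c'"
      by (simp add: \<theta> assms(3,5))
  qed
  moreover have "bij_betw \<theta> (carrier G) (carrier H)"
    unfolding assms(1,2)[symmetric] bij_betw_def inj_on_def using fibres
    by (auto simp: \<theta> image_image)
  ultimately show ?thesis
    unfolding is_iso_def iso_def by blast
qed

text \<open>The element is a sorted word, without inversions, minus the word with its two middle
  letters exchanged, which has exactly one. It shows that the inversion sum takes all integer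
  values.\<close>

lemma inversion_sum_comm_monomial:
  assumes "0 < a" "0 < b"
  shows "inversion_sum a b (gen X1 ^ (a - 1) * (gen X1 * gen X2 - gen X2 * gen X1) * gen X2 ^ (b - 1)) = - 1"
    and "gen X1 ^ (a - 1) * (gen X1 * gen X2 - gen X2 * gen X1) * gen X2 ^ (b - 1) \<in> bihomogeneous a b"
proof -
  obtain a' b' where ab: "a = Suc a'" "b = Suc b'"
    using assms gr0_implies_Suc by blast
  have z: "gen X1 ^ (a - 1) * (gen X1 * gen X2 - gen X2 * gen X1) * gen X2 ^ (b - 1)
     = frag_of (Word (replicate a' X1 @ X1 # X2 # replicate b' X2))
     - frag_of (Word (replicate a' X1 @ X2 # X1 # replicate b' X2))"
    unfolding gen_power unfolding gen_def
    by (simp add: ab left_diff_distrib right_diff_distrib mult_single plus_free_monoid_def)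
  show "inversion_sum a b (gen X1 ^ (a - 1) * (gen X1 * gen X2 - gen X2 * gen X1) * gen X2 ^ (b - 1)) = - 1"
    unfolding z inversion_sum_diff
    by (simp add: ab inversion_sum_def bidegree_def inversions_append count_list_replicate)
  show "gen X1 ^ (a - 1) * (gen X1 * gen X2 - gen X2 * gen X1) * gen X2 ^ (b - 1) \<in> bihomogeneous a b"
    unfolding z bihomogeneous_def using keys_diff
    by (fastforce simp: ab count_list_replicate)
qed

lemma bihomogeneous_diff: "f \<in> bihomogeneous a b \<Longrightarrow> g \<in> bihomogeneous a b \<Longrightarrow> f - g \<in> bihomogeneous a b"
  unfolding bihomogeneous_def using keys_diff[of f g] by blast

lemma bihomogeneous_add: "f \<in> bihomogeneous a b \<Longrightarrow> g \<in> bihomogeneous a b \<Longrightarrow> f + g \<in> bihomogeneous a b"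
  unfolding bihomogeneous_def using Poly_Mapping.keys_add[of f g] by blast

lemma bihomogeneous_of_int_mult:
  assumes "f \<in> bihomogeneous a b"
  shows "of_int k * f \<in> bihomogeneous a b"
proof -
  have nat: "of_nat i * f \<in> bihomogeneous a b" for i
    by (induction i) (simp_all add: algebra_simps bihomogeneous_add assms, simp add: bihomogeneous_def)
  show ?thesis
    by (cases k rule: int_diff_cases)
      (simp only: of_int_diff of_int_of_nat_eq left_diff_distrib bihomogeneous_diff nat)
qed

lemma integer_mod_group_1_eq: "integer_mod_group 1 = singleton_group 0"
  by (auto simp: integer_mod_group_def singleton_group_def)

lemma (in ring) lower_quotient_component_mult:
  "C \<otimes>\<^bsub>lower_quotient_component R H i\<^esub> C' = set_add R C C'"
  by (simp add: lower_quotient_component_def lower_quotient_def FactGroup_def set_add_def set_mult_def)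

lemma (in ideal) a_rcos_eq_iff:
  assumes "f \<in> carrier R" "g \<in> carrier R"
  shows "I +> f = I +> g \<longleftrightarrow> f \<ominus> g \<in> I"
  using assms a_rcos_module[of g f] a_repr_independence[of f I g] a_rcos_self[of f] a_subgroup
  by (metis a_minus_def)

theorem mainTheorem4:
  fixes m n a b :: nat
  assumes "m \<ge> 1" and "n \<ge> 1"
  shows "lower_quotient_component (truncated_ring m n) (truncated_component m n a b) 2 \<cong>
    (if 1 \<le> a \<and> a \<le> m - 1 \<and> 1 \<le> b \<and> b \<le> n - 1 then integer_group
     else if 1 \<le> a \<and> a \<le> m - 1 \<and> b = n then integer_mod_group n
     else if a = m \<and> 1 \<le> b \<and> b \<le> n - 1 then integer_mod_group m
     else if a = m \<and> b = n then integer_mod_group (gcd m n)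
     else singleton_group 0)"
proof -
  define I where "I = relations_ideal m n"
  define A where "A = truncated_ring m n"
  define h where "h = (+>\<^bsub>Free2\<^esub>) I"
  have I: "ideal I Free2"
    unfolding I_def relations_ideal_def by (simp add: ring.genideal_ideal ring_Free2)
  have A: "A = Free2 Quot I"
    by (simp add: A_def I_def truncated_ring_def)
  interpret ring Free2
    by (rule ring_Free2)
  interpret I: two_sided_ideal I
    using I by (simp add: ideal_Free2_iff)
  interpret h: ring_hom_ring Free2 A h
    unfolding h_def A by (rule ideal.rcos_ring_hom_ring[OF I])
  have h_simps: "h (f + g) = h f \<oplus>\<^bsub>A\<^esub> h g" "h (f - g) = h f \<ominus>\<^bsub>A\<^esub> h g" "h f \<in> carrier A" for f g
    using h.hom_add[of f g] h.hom_closed[of f] h.hom_add[of f "- g"] h.hom_a_inv[of g]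
    by (simp_all add: a_minus_def)
  have h_eq_iff: "h f = h g \<longleftrightarrow> f - g \<in> I" for f g
    using ideal.a_rcos_eq_iff[OF I, of f g] by (simp add: h_def)
  have I_gens: "gen X1 ^ m \<in> I" "gen X2 ^ n \<in> I"
    unfolding I_def relations_ideal_def using genideal_self[of "{gen X1 ^ m, gen X2 ^ n}"] by auto
  have I_model: "I \<subseteq> model_ideal m n"
    unfolding I_def relations_ideal_def
    by (rule genideal_minimal) (auto simp: ideal_Free2_iff two_sided_ideal_model_ideal gen_power_in_model_ideal)
  have M: "lower_ideal A i = h ` lower_ideal Free2 i" for i
    unfolding A h_def by (rule lower_ideal_quotient[OF I])
  have M_ideal: "ideal (lower_ideal A i) A" for i
    unfolding lower_ideal_def by (intro h.S.genideal_ideal h.S.lower_central_subset)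

  \<comment> \<open>The preimages of \<open>M_2(A)\<close> and \<open>M_3(A)\<close> allow all
    computations to take place in the free ring.\<close>
  define S T where "S = {f. h f \<in> lower_ideal A 2}" and "T = {f. h f \<in> lower_ideal A 3}"
  have ST_ideal: "two_sided_ideal S" "two_sided_ideal T"
    using h.ideal_vimage[OF M_ideal] by (simp_all add: S_def T_def flip: ideal_Free2_iff)
  interpret S: two_sided_ideal S by (rule ST_ideal)
  interpret T: free_double_commutator_ideal T
    by (intro free_double_commutator_ideal.intro double_commutator_ideal.intro ST_ideal
        double_commutator_ideal_axioms.intro) (simp add: T_def M double_commutator_in_lower_ideal)
  have I_T: "I \<subseteq> T"
  proof
    fix f assume "f \<in> I"
    then have "h f = h 0"
      by (simp add: h_eq_iff)
    moreover have "h 0 \<in> lower_ideal A 3"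
      using T.zero_mem by (simp add: T_def)
    ultimately show "f \<in> T"
      by (simp add: T_def)
  qed
  have lift: "f \<in> U" if f: "h f \<in> h ` V" and U: "two_sided_ideal U" "I \<subseteq> U" "V \<subseteq> U" for f U V
  proof -
    interpret U: two_sided_ideal U by fact
    obtain g where "g \<in> V" "f - g \<in> I"
      using f by (auto simp: h_eq_iff)
    then show ?thesis
      using U.add_mem[of "f - g" g] U by auto
  qed
  have T_model: "T \<subseteq> model_ideal m n"
    using lift[OF _ two_sided_ideal_model_ideal I_model lower_ideal_3_minimal[OF two_sided_ideal_model_ideal double_commutator_in_model_ideal]]
    by (auto simp: T_def M)
  have S_coeff: "coeff_sum a b f = 0" if "f \<in> S" "a < m" "b < n" for f
  proof -
    let ?V = "{f. \<forall>a b. a < m \<and> b < n \<longrightarrow> coeff_sum a b f = 0}"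
    have "I \<subseteq> ?V"
      using I_model by (auto simp: model_ideal_def)
    then have "f \<in> ?V"
      using lift[OF _ two_sided_ideal_coeff_sum _ lower_ideal_2_minimal[OF two_sided_ideal_coeff_sum], of f m n]
        that(1) by (auto simp: S_def M coeff_sum_commutator)
    with that show ?thesis
      by blast
  qed
  have z_S: "T.comm_monomial a b \<in> S"
    unfolding T.comm_monomial_def T.comm_def
    by (intro S.mult_left_mem S.mult_right_mem) (simp add: S_def M commutator_in_lower_ideal)
  let ?G = "lower_quotient_component (truncated_ring m n) (truncated_component m n a b) 2"
  define D where "D = S \<inter> bihomogeneous a b"
  define \<pi> where "\<pi> f = lower_ideal A 3 +>\<^bsub>A\<^esub> h f" for f
  \<comment> \<open>If a letter is absent there are no inversions and the component must vanish,
    whereas \<open>modulus\<close> can be 0 or large there; hence the value 1.\<close>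
  define d where "d = (if a = 0 \<or> b = 0 then 1 else modulus m n a b)"
  define \<rho> where "\<rho> f = inversion_sum a b f mod int d" for f
  \<comment> \<open>This is the kernel computation: the model ideal shows that the divisibility is
    necessary, and the normal form that it is sufficient.\<close>
  have mem_T_iff: "f \<in> T \<longleftrightarrow> int d dvd inversion_sum a b f" if f: "f \<in> D" for f
  proof
    assume "f \<in> T"
    then show "int d dvd inversion_sum a b f"
      using T_model by (auto simp: d_def model_ideal_def)
  next
    assume dvd: "int d dvd inversion_sum a b f"
    \<comment> \<open>The commutative term of the normal form lies in \<open>T\<close> in either
      case: for large exponents the monomial is in \<open>I\<close>, otherwise its coefficient is 0
      because \<open>f\<close> is in \<open>S\<close>.\<close>
    have "gen X1 ^ a * gen X2 ^ b \<in> I" if "m \<le> a \<or> n \<le> b"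
      using that
    proof
      assume "m \<le> a"
      then have "gen X1 ^ a = gen X1 ^ m * gen X1 ^ (a - m)"
        by (simp flip: power_add)
      then show ?thesis
        using I_gens by (simp add: I.mult_right_mem)
    next
      assume "n \<le> b"
      then have "gen X2 ^ b = gen X2 ^ (b - n) * gen X2 ^ n"
        by (simp flip: power_add)
      then show ?thesis
        using I_gens by (simp add: I.mult_left_mem)
    qed
    then have "of_int (coeff_sum a b f) * (gen X1 ^ a * gen X2 ^ b) \<in> T"
      using S_coeff[of f] f I_T T.zero_mem
      by (cases "m \<le> a \<or> n \<le> b") (auto simp: D_def intro: T.mult_left_mem)
    moreover have "of_int (inversion_sum a b f) * T.comm_monomial a b \<in> T"
    proof (cases "a = 0 \<or> b = 0")
      case True
      then show ?thesis
        by (simp add: inversion_sum_eq_0 T.zero_mem)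
    next
      case False
      then show ?thesis
        using dvd I_gens I_T by (intro T.int_multiple_comm_monomial) (auto simp: d_def)
    qed
    ultimately have "of_int (coeff_sum a b f) * (gen X1 ^ a * gen X2 ^ b)
        - of_int (inversion_sum a b f) * T.comm_monomial a b \<in> T"
      by (rule T.diff_mem)
    moreover have "T.cong f (of_int (coeff_sum a b f) * (gen X1 ^ a * gen X2 ^ b)
        - of_int (inversion_sum a b f) * T.comm_monomial a b)"
      using f by (simp add: D_def T.bihomogeneous_cong)
    ultimately show "f \<in> T"
      using T.cong_trans T.cong_0_iff by blast
  qed
  have "?G \<cong> integer_mod_group d"
  \<comment> \<open>The component of \<open>N_2(A)\<close> and the cyclic group are both images of
    \<open>D\<close>, under the class map \<open>\<pi>\<close> and the inversion sum modulo
    \<open>d\<close>.\<close>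
  proof (rule iso_of_equal_fibres)
    show "\<pi> ` D = carrier ?G"
      by (auto simp: lower_quotient_component_def truncated_component_def \<pi>_def D_def S_def h_def
          numeral_2_eq_2 numeral_3_eq_3 simp flip: A_def I_def)
    show "\<rho> ` D = carrier (integer_mod_group d)"
    proof
      show "\<rho> ` D \<subseteq> carrier (integer_mod_group d)"
        by (auto simp: \<rho>_def carrier_integer_mod_group)
      show "carrier (integer_mod_group d) \<subseteq> \<rho> ` D"
      proof
        fix k assume k: "k \<in> carrier (integer_mod_group d)"
        show "k \<in> \<rho> ` D"
        proof (cases "a = 0 \<or> b = 0")
          case True
          then have "k = \<rho> 0"
            using k by (auto simp: d_def \<rho>_def carrier_integer_mod_group)
          moreover have "0 \<in> D"
            by (simp add: D_def S.zero_mem bihomogeneous_def)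
          ultimately show ?thesis
            by blast
        next
          case False
          \<comment> \<open>The sign compensates for the inversion sum \<open>-1\<close> of the
            monomial.\<close>
          define f where "f = of_int (- k) * T.comm_monomial a b"
          have "inversion_sum a b f = k"
            using False inversion_sum_comm_monomial(1)[of a b]
            by (simp add: f_def T.comm_monomial_def T.comm_def inversion_sum_of_int_mult del: of_int_minus)
          moreover have "f \<in> D"
            using False inversion_sum_comm_monomial(2)[of a b] z_S
            by (simp add: f_def D_def T.comm_monomial_def T.comm_def S.mult_left_mem bihomogeneous_of_int_mult del: of_int_minus)
          ultimately show ?thesis
            using k by (auto simp: \<rho>_def carrier_integer_mod_group image_iff split: if_splits intro!: bexI[of _ f])
        qed
      qed
    qed
    show "f + g \<in> D" if "f \<in> D" "g \<in> D" for f g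
      using that by (simp add: D_def S.add_mem bihomogeneous_add)
    show "\<pi> (f + g) = \<pi> f \<otimes>\<^bsub>?G\<^esub> \<pi> g" for f g
    proof -
      interpret M: ideal "lower_ideal A 3" A
        by (rule M_ideal)
      show ?thesis
        unfolding \<pi>_def A_def[symmetric] h.S.lower_quotient_component_mult
        by (simp add: h_simps M.a_rcos_sum)
    qed
    show "\<rho> (f + g) = \<rho> f \<otimes>\<^bsub>integer_mod_group d\<^esub> \<rho> g" for f g
      by (simp add: \<rho>_def inversion_sum_add mod_add_eq)
    show "\<pi> f = \<pi> g \<longleftrightarrow> \<rho> f = \<rho> g" if "f \<in> D" "g \<in> D" for f g
    proof -
      have "\<pi> f = \<pi> g \<longleftrightarrow> f - g \<in> T"
        unfolding \<pi>_def T_def using ideal.a_rcos_eq_iff[OF M_ideal] by (simp add: h_simps)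
      also have "\<dots> \<longleftrightarrow> int d dvd inversion_sum a b f - inversion_sum a b g"
        using mem_T_iff[of "f - g"] that
        by (simp add: D_def S.diff_mem bihomogeneous_diff inversion_sum_diff)
      also have "\<dots> \<longleftrightarrow> \<rho> f = \<rho> g"
        by (simp add: \<rho>_def mod_eq_dvd_iff)
      finally show ?thesis .
    qed
  qed
  moreover have "integer_mod_group d =
    (if 1 \<le> a \<and> a \<le> m - 1 \<and> 1 \<le> b \<and> b \<le> n - 1 then integer_group
     else if 1 \<le> a \<and> a \<le> m - 1 \<and> b = n then integer_mod_group n
     else if a = m \<and> 1 \<le> b \<and> b \<le> n - 1 then integer_mod_group m
     else if a = m \<and> b = n then integer_mod_group (gcd m n)
     else singleton_group 0)"
  proof -
    \<comment> \<open>In the interior of the rectangle \<open>d = 0\<close> stands for the infinite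
      cyclic group; outside the listed ranges \<open>d = 1\<close> gives the trivial one.\<close>
    have "integer_mod_group 0 = integer_group"
      by (simp add: integer_mod_group_def)
    with assms integer_mod_group_1_eq show ?thesis
      by (auto simp: d_def modulus_def)
  qed
  ultimately show ?thesis
    by simp
qed

end
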